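(* Consider the finite-horizon ($T<\infty$) BCR-SOC/MDP problem described in the context and define $$V_T^*(s_T,\mu_T)=\mathcal C_T(s_T),\qquad (s_T,\mu_T)\in\mathcal S\times\mathcal D_1^p,$$ $$V_t^*(s_t,\mu_t)=\inf_{a_t\in\mathcal A}\rho_{\mu_t}\circ\rho_{P_{\theta_t}}\big[\mathcal C_t(s_t,a_t,\xi_t)+\gamma V_{t+1}^*(s_{t+1},\mu_{t+1})\big],\qquad (s_t,\mu_t)\in\mathcal S\times\mathcal D_1^p,\ t=1,\dots,T-1,$$ where $s_{t+1}=g_t(s_t,a_t,\xi_t)$ and $\mu_{t+1}$ is the Bayes update of $\mu_t$ given $\xi_t$. Suppose that for each $t=1,\dots,T-1$ and every $(s_t,\mu_t)\in\mathcal S\times\mathcal D_1^p$ the infimum is attained, and that Assumption A of the context holds. Let $\mathcal J_T^{\gamma,*}(s_1,\mu_1)$ denote the optimal value of the BCR-SOC/MDP problem. Then $$\mathcal J_T^{\gamma,*}(s_1,\mu_1)=V_1^*(s_1,\mu_1).$$ Moreover, an optimal policy $\pi^*=\{\pi_1^*,\dots,\pi_{T-1}^*\}$ corresponding to $\mathcal J_T^{\gamma,*}(s_1,\mu_1)$ exists and can be determined recursively by $$\pi_t^*(s_t,\mu_t)\in\arg\min_{a\in\mathcal A}\rho_{\mu_t}\circ\rho_{P_{\theta_t}}\big[\mathcal C_t(s_t,a,\xi_t)+\gamma V_{t+1}^*(s_{t+1},\mu_{t+1})\big],\quad s_{t+1}=g_t(s_t,a,\xi_t).$$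
   Context: Risk measures: a map $\rho:L^p\to\mathbb R$ is a monetary risk measure if $X\ge Y$ pointwise implies $\rho(X)\ge\rho(Y)$ and $\rho(X+c)=\rho(X)+c$ for $c\in\mathbb R$; it is law invariant if $\rho(X)$ depends only on the distribution of $X$. The inner and outer risk measures are law invariant monetary risk measures. $\mathcal M_1^{q}$ is the set of probability measures on $\mathbb R$ with finite $q$-th absolute moment. $\rho_{P_\theta}(Z(\xi))$ denotes the value of the inner risk measure at the law of $Z(\xi)$ when $\xi\sim P_\theta$; for a density $\mu$ on $\Theta\subseteq\mathbb R$, $\rho_\mu(Y(\theta))$ denotes the value of the outer risk measure at the law of $Y(\theta)$ when $\theta\sim\mu$; and $\rho_\mu\circ\rho_{P_\theta}(Z):=\rho_\mu\big(\theta\mapsto\rho_{P_\theta}(Z(\xi))\big)$. BCR-SOC/MDP problem: $\mathcal S$ is the state space, $\mathcal A$ the action space, $\Xi$ the support of the random vectors $\xi_t$, $g_t:\mathcal S\times\mathcal A\times\Xi\to\mathcal S$ the transition maps, $\mathcal C_t(s_t,a_t,\xi_t)$ ($t\le T-1$) and $\mathcal C_T(s_T)$ the costs, $\gamma\in(0,1]$ a discount factor. $\mathcal D_1^p$ is the set of densities on $\Theta$ whose distributions lie in $\mathcal M_1^p$. A policy is $\pi=(\pi_1,\dots,\pi_{T-1})$ with $\pi_t:\mathcal S\times\mathcal D_1^p\to\mathcal A$. The problem is to minimize over $\pi$ $$\rho_{\mu_1}\circ\rho_{P_{\theta_1}}\Big[\mathcal C_1(s_1,a_1,\xi_1)+\cdots+\gamma\,\rho_{\mu_{T-1}}\circ\rho_{P_{\theta_{T-1}}}\big[\mathcal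 C_{T-1}(s_{T-1},a_{T-1},\xi_{T-1})+\gamma\,\mathcal C_T(s_T)\big]\Big]$$ subject to $s_{t+1}=g_t(s_t,a_t,\xi_t)$, $a_t=\pi_t(s_t,\mu_t)$, and the Bayes update $\mu_{t+1}(\theta)=\frac{p(\xi_t|\theta)\mu_t(\theta)}{\int_\Theta p(\xi_t|\theta)\mu_t(\theta)\,d\theta}$, $t=1,\dots,T-1$, where $p(\cdot|\theta)$ is the density of $P_\theta$ and $\theta_t$ has density $\mu_t$. Assumption A: (a) Each $\mathcal C_t$ is continuous, and for some positive constants $\kappa_{\mathcal C},\upsilon$: $|\mathcal C_t(s_t,a_t,\xi_t)|\le \kappa_{\mathcal C}(|\xi_t|^{\upsilon}+1)$ for all arguments, $t=1,\dots,T-1$, and $|\mathcal C_T(g_{T-1}(s_{T-1},a_{T-1},\xi_{T-1}))|\le \kappa_{\mathcal C}(|\xi_{T-1}|^{\upsilon}+1)$ for all arguments. (b) For $t=1,\dots,T-1$, $\rho_{P_{\theta_t}}:L^{\upsilon}\to\mathbb R$ is a continuous law invariant monetary risk measure with $\rho_{P_{\theta_t}}(|\xi_t|^{\upsilon})<\infty$ for all $\theta_t\in\Theta$, and $\rho_{\mu_t}\circ\rho_{P_{\theta_t}}(|\xi_t|^{\upsilon})\le \kappa_\rho(|\xi_{t-1}|^{\upsilon}+1)$ with a positive constant $\kappa_\rho$ depending on $t$ ($\xi_0$ a fixed constant). (c) $\xi_1,\dots,\xi_T$ are i.i.d. with true unknown distribution $P_{\theta^c}$ belonging to a parametric family $\{P_\theta:\theta\in\Theta\}$,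 $P_\theta\in\mathcal M_1^{\upsilon p}$ for all $\theta$. (d) $p(\xi|\theta)$ is continuous in $\theta$ over $\Theta\subset\mathbb R$. (e) $\mathcal A$ is compact and convex. *)

theory Defs
  imports "HOL-Probability.Probability"
begin

section \<open>Law invariant monetary risk measures\<close>

definition finite_moment :: "real \<Rightarrow> 'x::euclidean_space measure set" where
  "finite_moment q =
    {Q. prob_space Q \<and> sets Q = sets borel \<and> integrable Q (\<lambda>x. norm x powr q)}"

definition Lp :: "'w measure \<Rightarrow> real \<Rightarrow> ('w \<Rightarrow> real) set" where
  "Lp M q = {X \<in> borel_measurable M. integrable M (\<lambda>w. \<bar>X w\<bar> powr q)}"

definition monetary :: "'w measure \<Rightarrow> real \<Rightarrow> (('w \<Rightarrow> real) \<Rightarrow> real) \<Rightarrow> bool" where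
  "monetary M q \<rho> \<longleftrightarrow>
    (\<forall>X\<in>Lp M q. \<forall>Y\<in>Lp M q. (\<forall>w\<in>space M. X w \<ge> Y w) \<longrightarrow> \<rho> X \<ge> \<rho> Y) \<and>
    (\<forall>X\<in>Lp M q. \<forall>c. \<rho> (\<lambda>w. X w + c) = \<rho> X + c)"

definition law_invariant :: "'w measure \<Rightarrow> real \<Rightarrow> (('w \<Rightarrow> real) \<Rightarrow> real) \<Rightarrow> bool" where
  "law_invariant M q \<rho> \<longleftrightarrow>
    (\<forall>X\<in>Lp M q. \<forall>Y\<in>Lp M q. distr M borel X = distr M borel Y \<longrightarrow> \<rho> X = \<rho> Y)"

text \<open>Convergence of \<open>X n\<close> to \<open>Y\<close> is convergence of the \<open>q\<close>-th absolute moment of the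
  difference, so that exponents below one are allowed; this topology is metrizable.\<close>

definition Lp_continuous :: "'w measure \<Rightarrow> real \<Rightarrow> (('w \<Rightarrow> real) \<Rightarrow> real) \<Rightarrow> bool" where
  "Lp_continuous M q \<rho> \<longleftrightarrow>
    (\<forall>X Y. (\<forall>n. X n \<in> Lp M q) \<and> Y \<in> Lp M q \<and>
       (\<lambda>n. \<integral>w. \<bar>X n w - Y w\<bar> powr q \<partial>M) \<longlonglongrightarrow> 0 \<longrightarrow>
       (\<lambda>n. \<rho> (X n)) \<longlonglongrightarrow> \<rho> Y)"

text \<open>On an atomless probability space, i.e. one that carries a uniform random variable, every
  law on the real line is the law of some random variable, so a law invariant risk measure has a
  value at every law with a finite \<open>q\<close>-th moment.\<close>

definition atomless_prob_space :: "'w measure \<Rightarrow> bool" where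
  "atomless_prob_space M \<longleftrightarrow> prob_space M \<and>
    (\<exists>U\<in>borel_measurable M. distr M borel U = uniform_measure lborel {0..1::real})"

definition risk_at_law ::
    "'w measure \<Rightarrow> real \<Rightarrow> (('w \<Rightarrow> real) \<Rightarrow> real) \<Rightarrow> real measure \<Rightarrow> real" where
  "risk_at_law M q \<rho> L = \<rho> (SOME X. X \<in> Lp M q \<and> distr M borel X = L)"

text \<open>The value of \<open>\<rho>\<close> at the law of \<open>Z\<close> under \<open>Q\<close>. When \<open>Z\<close> agrees \<open>Q\<close>-almost everywhere with
  some \<open>X\<close> in \<open>L\<^sup>q(Q)\<close>, this is the value at the law of \<open>X\<close>. Otherwise (\<open>Z\<close> is not
  measurable, or lacks a finite \<open>q\<close>-th moment) \<open>\<rho>\<close> has no value at \<open>Z\<close>, and the monotone upper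
  extension is used, as for outer integrals. The nested risks below are thereby
  defined for all policies, without conditions of measurability.\<close>

definition risk_under ::
    "'w measure \<Rightarrow> real \<Rightarrow> (('w \<Rightarrow> real) \<Rightarrow> real) \<Rightarrow> 'y measure \<Rightarrow> ('y \<Rightarrow> ereal) \<Rightarrow> ereal" where
  "risk_under M q \<rho> Q Z =
    (if \<exists>X\<in>Lp Q q. AE y in Q. Z y = ereal (X y)
     then ereal (risk_at_law M q \<rho>
            (distr Q borel (SOME X. X \<in> Lp Q q \<and> (AE y in Q. Z y = ereal (X y)))))
     else (INF X\<in>{X \<in> Lp Q q. AE y in Q. Z y \<le> ereal (X y)}.
            ereal (risk_at_law M q \<rho> (distr Q borel X))))"

lemma risk_at_law_distr:
  assumes "law_invariant M q \<rho>" "W \<in> Lp M q"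
  shows "risk_at_law M q \<rho> (distr M borel W) = \<rho> W"
proof -
  define Y where "Y = (SOME X. X \<in> Lp M q \<and> distr M borel X = distr M borel W)"
  have "Y \<in> Lp M q \<and> distr M borel Y = distr M borel W"
    unfolding Y_def by (rule someI[of _ W]) (use assms(2) in simp)
  then show ?thesis
    using assms unfolding law_invariant_def risk_at_law_def Y_def by blast
qed

lemma risk_under_Lp:
  assumes "law_invariant M q \<rho>" "W \<in> Lp M q" "X \<in> Lp Q q"
    and "distr Q borel X = distr M borel W"
  shows "risk_under M q \<rho> Q (\<lambda>y. ereal (X y)) = ereal (\<rho> W)"
proof -
  let ?P = "\<lambda>X'. X' \<in> Lp Q q \<and> (AE y in Q. ereal (X y) = ereal (X' y))"
  define Y where "Y = (SOME X'. ?P X')"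
  have Y: "?P Y"
    unfolding Y_def by (rule someI[of _ X]) (use assms(3) in simp)
  have "distr Q borel Y = distr Q borel X"
    by (rule distr_cong_AE) (use Y assms(3) in \<open>auto simp: Lp_def\<close>)
  moreover have "\<exists>X'\<in>Lp Q q. AE y in Q. ereal (X y) = ereal (X' y)"
    using Y by blast
  ultimately show ?thesis
    unfolding risk_under_def Y_def[symmetric]
    using assms risk_at_law_distr[OF assms(1,2)] by simp
qed

section \<open>The Bayesian composite risk control problem\<close>

text \<open>\<open>lik x \<theta>\<close> is the density \<open>p(x|\<theta>)\<close> of \<open>family \<theta>\<close> with respect to \<open>dom\<close>
  (Lebesgue measure, counting measure, ...). \<open>noise t\<close>, \<open>t \<ge> 1\<close>, is the random vector
  \<open>\<xi>\<^sub>t\<close>, and \<open>noise0\<close> is the constant \<open>\<xi>\<^sub>0\<close>. The risk measures \<open>inner\<close> and \<open>outer\<close> act on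
  \<open>L\<^sup>\<upsilon>\<close> and \<open>L\<^sup>p\<close> of \<open>base\<close>, where \<open>inner_exp = \<upsilon>\<close> and \<open>outer_exp = p\<close>.\<close>

record ('s, 'a, 'x, 'w) bcr =
  base :: "'w measure"
  inner :: "('w \<Rightarrow> real) \<Rightarrow> real"
  outer :: "('w \<Rightarrow> real) \<Rightarrow> real"
  inner_exp :: real
  outer_exp :: real
  horizon :: nat
  states :: "'s set"
  actions :: "'a set"
  outcomes :: "'x set"
  trans_map :: "nat \<Rightarrow> 's \<Rightarrow> 'a \<Rightarrow> 'x \<Rightarrow> 's"
  stage_cost :: "nat \<Rightarrow> 's \<Rightarrow> 'a \<Rightarrow> 'x \<Rightarrow> real"
  final_cost :: "'s \<Rightarrow> real"
  discount :: real
  params :: "real set"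
  true_param :: real
  dom :: "'x measure"
  lik :: "'x \<Rightarrow> real \<Rightarrow> real"
  family :: "real \<Rightarrow> 'x measure"
  noise :: "nat \<Rightarrow> 'w \<Rightarrow> 'x"
  noise0 :: 'x

definition belief_law :: "(real \<Rightarrow> real) \<Rightarrow> real measure" where
  "belief_law \<mu> = density lborel (\<lambda>\<theta>. ennreal (\<mu> \<theta>))"

text \<open>Densities on \<open>\<Theta>\<close> are extended by zero to the whole line.\<close>

definition beliefs :: "('s, 'a, 'x, 'w) bcr \<Rightarrow> (real \<Rightarrow> real) set" where
  "beliefs D = {\<mu> \<in> borel_measurable borel. (\<forall>\<theta>. 0 \<le> \<mu> \<theta>) \<and> (\<forall>\<theta>. \<theta> \<notin> params D \<longrightarrow> \<mu> \<theta> = 0) \<and>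
     belief_law \<mu> \<in> finite_moment (outer_exp D)}"

definition bayes_update :: "('s, 'a, 'x, 'w) bcr \<Rightarrow> (real \<Rightarrow> real) \<Rightarrow> 'x \<Rightarrow> real \<Rightarrow> real" where
  "bayes_update D \<mu> x =
     (\<lambda>\<theta>. lik D x \<theta> * \<mu> \<theta> / (LINT \<theta>':params D|lborel. lik D x \<theta>' * \<mu> \<theta>'))"

definition composite_risk ::
    "('s, 'a, 'x, 'w) bcr \<Rightarrow> (real \<Rightarrow> real) \<Rightarrow> ('x \<Rightarrow> ereal) \<Rightarrow> ereal" where
  "composite_risk D \<mu> Z =
     risk_under (base D) (outer_exp D) (outer D) (belief_law \<mu>)
       (\<lambda>\<theta>. risk_under (base D) (inner_exp D) (inner D) (family D \<theta>) Z)"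

definition stage_risk ::
    "('s, 'a, 'x, 'w) bcr \<Rightarrow> nat \<Rightarrow> ('s \<Rightarrow> (real \<Rightarrow> real) \<Rightarrow> ereal) \<Rightarrow>
     's \<Rightarrow> (real \<Rightarrow> real) \<Rightarrow> 'a \<Rightarrow> ereal" where
  "stage_risk D t W s \<mu> a =
     composite_risk D \<mu>
       (\<lambda>x. ereal (stage_cost D t s a x)
            + ereal (discount D) * W (trans_map D t s a x) (bayes_update D \<mu> x))"

function opt_value ::
    "('s, 'a, 'x, 'w) bcr \<Rightarrow> nat \<Rightarrow> 's \<Rightarrow> (real \<Rightarrow> real) \<Rightarrow> ereal" where
  "opt_value D t s \<mu> =
     (if t < horizon D
      then INF a\<in>actions D. stage_risk D t (\<lambda>s' \<mu>'. opt_value D (Suc t) s' \<mu>') s \<mu> a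
      else ereal (final_cost D s))"
  by pat_completeness auto
termination by (relation "Wellfounded.measure (\<lambda>(D, t, _). horizon D - t)") auto

declare opt_value.simps [simp del]

text \<open>The nested objective, from stage \<open>t\<close> on, of the policy \<open>\<pi>\<close>.\<close>

function policy_cost ::
    "('s, 'a, 'x, 'w) bcr \<Rightarrow> (nat \<Rightarrow> 's \<Rightarrow> (real \<Rightarrow> real) \<Rightarrow> 'a) \<Rightarrow>
     nat \<Rightarrow> 's \<Rightarrow> (real \<Rightarrow> real) \<Rightarrow> ereal" where
  "policy_cost D \<pi> t s \<mu> =
     (if t < horizon D
      then stage_risk D t (\<lambda>s' \<mu>'. policy_cost D \<pi> (Suc t) s' \<mu>') s \<mu> (\<pi> t s \<mu>)
      else ereal (final_cost D s))"
  by pat_completeness auto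
termination by (relation "Wellfounded.measure (\<lambda>(D, \<pi>, t, _). horizon D - t)") auto

declare policy_cost.simps [simp del]

definition policies :: "('s, 'a, 'x, 'w) bcr \<Rightarrow> (nat \<Rightarrow> 's \<Rightarrow> (real \<Rightarrow> real) \<Rightarrow> 'a) set" where
  "policies D = {\<pi>. \<forall>t\<in>{1..<horizon D}. \<forall>s\<in>states D. \<forall>\<mu>\<in>beliefs D. \<pi> t s \<mu> \<in> actions D}"

definition problem_value ::
    "('s, 'a, 'x, 'w) bcr \<Rightarrow> 's \<Rightarrow> (real \<Rightarrow> real) \<Rightarrow> ereal" where
  "problem_value D s \<mu> = (INF \<pi>\<in>policies D. policy_cost D \<pi> 1 s \<mu>)"

definition optimal_policy ::
    "('s, 'a, 'x, 'w) bcr \<Rightarrow> 's \<Rightarrow> (real \<Rightarrow> real) \<Rightarrow>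
     (nat \<Rightarrow> 's \<Rightarrow> (real \<Rightarrow> real) \<Rightarrow> 'a) \<Rightarrow> bool" where
  "optimal_policy D s \<mu> \<pi> \<longleftrightarrow> \<pi> \<in> policies D \<and> policy_cost D \<pi> 1 s \<mu> = problem_value D s \<mu>"

definition minimizing_action ::
    "('s, 'a, 'x, 'w) bcr \<Rightarrow> nat \<Rightarrow> 's \<Rightarrow> (real \<Rightarrow> real) \<Rightarrow> 'a \<Rightarrow> bool" where
  "minimizing_action D t s \<mu> a \<longleftrightarrow>
     is_arg_min (stage_risk D t (opt_value D (Suc t)) s \<mu>) (\<lambda>b. b \<in> actions D) a"

definition recursive_policy ::
    "('s, 'a, 'x, 'w) bcr \<Rightarrow> (nat \<Rightarrow> 's \<Rightarrow> (real \<Rightarrow> real) \<Rightarrow> 'a) \<Rightarrow> bool" where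
  "recursive_policy D \<pi> \<longleftrightarrow>
     (\<forall>t\<in>{1..<horizon D}. \<forall>s\<in>states D. \<forall>\<mu>\<in>beliefs D. minimizing_action D t s \<mu> (\<pi> t s \<mu>))"

section \<open>Standing setting and assumptions\<close>

definition msupport :: "'x::topological_space measure \<Rightarrow> 'x set" where
  "msupport Q = {x. \<forall>U. open U \<and> x \<in> U \<longrightarrow> 0 < emeasure Q U}"

definition bcr_problem ::
    "('s::topological_space, 'a::real_normed_vector, 'x::euclidean_space, 'w) bcr \<Rightarrow> bool" where
  "bcr_problem D \<longleftrightarrow>
     atomless_prob_space (base D) \<and>
     0 < inner_exp D \<and> 0 < outer_exp D \<and>
     monetary (base D) (outer_exp D) (outer D) \<and>
     law_invariant (base D) (outer_exp D) (outer D) \<and>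
     1 \<le> horizon D \<and> 0 < discount D \<and> discount D \<le> 1 \<and>
     (\<forall>t\<in>{1..<horizon D}. \<forall>s\<in>states D. \<forall>a\<in>actions D. \<forall>x\<in>outcomes D.
        trans_map D t s a x \<in> states D) \<and>
     params D \<in> sets borel \<and> true_param D \<in> params D \<and>
     sigma_finite_measure (dom D) \<and> sets (dom D) = sets borel \<and>
     (\<forall>\<theta>\<in>params D.
        (\<lambda>x. lik D x \<theta>) \<in> borel_measurable borel \<and> (\<forall>x. 0 \<le> lik D x \<theta>) \<and>
        family D \<theta> = density (dom D) (\<lambda>x. ennreal (lik D x \<theta>)) \<and>
        prob_space (family D \<theta>) \<and> (AE x in family D \<theta>. x \<in> outcomes D)) \<and>
     outcomes D = msupport (family D (true_param D))"

primrec posterior ::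
    "('s, 'a, 'x, 'w) bcr \<Rightarrow> (real \<Rightarrow> real) \<Rightarrow> (nat \<Rightarrow> 'x) \<Rightarrow> nat \<Rightarrow> real \<Rightarrow> real" where
  "posterior D \<mu> x 0 = \<mu>"
| "posterior D \<mu> x (Suc n) = bayes_update D (posterior D \<mu> x n) (x (Suc n))"

text \<open>In the last clause of \<open>assumption_b\<close>, \<open>posterior D \<mu>1 x (t - 1)\<close> is the belief
  \<open>\<mu>\<^sub>t\<close> reached from the prior \<open>\<mu>1\<close> after observing \<open>x 1, ..., x (t - 1)\<close>; only observations
  along which the Bayes updates are defined and stay in the belief space are considered.\<close>

definition assumption_a ::
    "('s::topological_space, 'a::real_normed_vector, 'x::euclidean_space, 'w) bcr \<Rightarrow> bool" where
  "assumption_a D \<longleftrightarrow>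
     (\<forall>t\<in>{1..<horizon D}. continuous_on (states D \<times> actions D \<times> outcomes D)
        (\<lambda>(s, a, x). stage_cost D t s a x)) \<and>
     continuous_on (states D) (final_cost D) \<and>
     (\<exists>\<kappa>>0.
        (\<forall>t\<in>{1..<horizon D}. \<forall>s\<in>states D. \<forall>a\<in>actions D. \<forall>x\<in>outcomes D.
           \<bar>stage_cost D t s a x\<bar> \<le> \<kappa> * (norm x powr inner_exp D + 1)) \<and>
        (2 \<le> horizon D \<longrightarrow>
           (\<forall>s\<in>states D. \<forall>a\<in>actions D. \<forall>x\<in>outcomes D.
              \<bar>final_cost D (trans_map D (horizon D - 1) s a x)\<bar>
                \<le> \<kappa> * (norm x powr inner_exp D + 1))))"

definition assumption_b ::
    "('s, 'a, 'x::euclidean_space, 'w) bcr \<Rightarrow> (real \<Rightarrow> real) \<Rightarrow> bool" where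
  "assumption_b D \<mu>1 \<longleftrightarrow>
     monetary (base D) (inner_exp D) (inner D) \<and>
     law_invariant (base D) (inner_exp D) (inner D) \<and>
     Lp_continuous (base D) (inner_exp D) (inner D) \<and>
     (\<forall>\<theta>\<in>params D. risk_under (base D) (inner_exp D) (inner D) (family D \<theta>)
        (\<lambda>x. ereal (norm x powr inner_exp D)) < \<infinity>) \<and>
     (\<forall>t\<in>{1..<horizon D}. \<exists>\<kappa>>0. \<forall>x.
        x 0 = noise0 D \<and> (\<forall>i\<in>{1..<t}. x i \<in> outcomes D) \<and>
        (\<forall>n<t. posterior D \<mu>1 x n \<in> beliefs D) \<longrightarrow>
        composite_risk D (posterior D \<mu>1 x (t - 1)) (\<lambda>y. ereal (norm y powr inner_exp D))
          \<le> ereal (\<kappa> * (norm (x (t - 1)) powr inner_exp D + 1)))"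

definition assumption_c :: "('s, 'a, 'x::euclidean_space, 'w) bcr \<Rightarrow> bool" where
  "assumption_c D \<longleftrightarrow>
     prob_space.indep_vars (base D) (\<lambda>_. borel) (noise D) {1..horizon D} \<and>
     (\<forall>t\<in>{1..horizon D}. distr (base D) borel (noise D t) = family D (true_param D)) \<and>
     (\<forall>\<theta>\<in>params D. family D \<theta> \<in> finite_moment (inner_exp D * outer_exp D))"

definition assumption_d :: "('s, 'a, 'x, 'w) bcr \<Rightarrow> bool" where
  "assumption_d D \<longleftrightarrow> (\<forall>x\<in>outcomes D. continuous_on (params D) (lik D x))"

definition assumption_e :: "('s, 'a::real_normed_vector, 'x, 'w) bcr \<Rightarrow> bool" where
  "assumption_e D \<longleftrightarrow> compact (actions D) \<and> convex (actions D)"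

definition assumption_A ::
    "('s::topological_space, 'a::real_normed_vector, 'x::euclidean_space, 'w) bcr \<Rightarrow>
     (real \<Rightarrow> real) \<Rightarrow> bool" where
  "assumption_A D \<mu>1 \<longleftrightarrow>
     assumption_a D \<and> assumption_b D \<mu>1 \<and> assumption_c D \<and> assumption_d D \<and> assumption_e D"

end

theory Submission
  imports Defs
begin

text \<open>The statement is the verification theorem of dynamic programming for the nested objective.
  It rests on one property: the stage risk is monotone in the continuation value
  (\<open>stage_risk_mono\<close>). Given this, backward induction shows that the optimal value is a lower
  bound for the cost of every policy (\<open>opt_value_le_policy_cost\<close>), and that it is the cost of
  a policy which picks a minimizer at every stage (\<open>policy_cost_recursive\<close>). Such policies exist
  because the infima are attained.

  Monotonicity of the stage risk has two parts. First, the value of a risk measure at the law of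
  \<open>Z\<close> is monotone in \<open>Z\<close>, even for an almost everywhere inequality and for \<open>Z\<close> that is not
  measurable or integrable (\<open>risk_under_mono\<close>); this uses a quantile coupling on the atomless
  base space. It is essential that arbitrary \<open>Z\<close> are covered, since neither the optimal value
  nor the cost of a policy need be measurable in the observation. Secondly, the induction
  hypothesis is available only at beliefs, whereas the Bayes formula can
  leave the belief space, for instance when the evidence is zero or the posterior has no
  finite moment. The exceptional observations are negligible for the composite risk: for almost
  every parameter under the current belief, they are a null set of the model with this parameter
  (\<open>AE_bayes_update_beliefs\<close>).\<close>

section \<open>Monotonicity of the value of a risk measure at a law\<close>

text \<open>Outside the open unit interval the infimum may be over an empty or unbounded set; the value
  zero there keeps the quantile functions of stochastically ordered laws ordered at every \<open>u\<close>,
  as monotonicity of a risk measure asks for a pointwise comparison.\<close>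

definition quantile :: "real measure \<Rightarrow> real \<Rightarrow> real" where
  "quantile L u = (if u \<in> {0<..<1} then Inf {x. u \<le> cdf L x} else 0)"

lemma measurable_quantile:
  assumes "real_distribution L"
  shows "quantile L \<in> borel_measurable borel"
proof -
  interpret cdf_distribution L
    using assms by (simp add: cdf_distribution_def)
  have "(\<lambda>u. if u \<in> {0<..<1} then Inf {x. u \<le> cdf L x} else 0) \<in> borel_measurable borel"
    using measurable_CI by (subst measurable_restrict_space_iff[symmetric]) auto
  then show ?thesis
    by (simp add: quantile_def[abs_def])
qed

lemma distr_quantile_uniform:
  assumes "real_distribution L"
  shows "distr (uniform_measure lborel {0..1}) borel (quantile L) = L"
proof -
  interpret cdf_distribution L
    using assms by (simp add: cdf_distribution_def)
  have [measurable]: "quantile L \<in> borel_measurable borel"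
    by (rule measurable_quantile) fact
  have "emeasure (distr (uniform_measure lborel {0..1}) borel (quantile L)) A
      = emeasure (distr (restrict_space lborel {0<..<1}) borel I) A"
    if [measurable]: "A \<in> sets borel" for A
  proof -
    have vimage: "quantile L -` A \<in> sets borel"
      by (rule measurable_sets_borel) measurable
    have "emeasure (distr (uniform_measure lborel {0..1}) borel (quantile L)) A
        = emeasure lborel ({0..1} \<inter> quantile L -` A)"
      using vimage by (subst emeasure_distr) (auto simp: emeasure_uniform_measure divide_ennreal_def)
    also have "\<dots> = emeasure lborel ({0<..<1} \<inter> quantile L -` A)"
      using AE_lborel_singleton[of "0::real"] AE_lborel_singleton[of "1::real"]
      by (intro emeasure_eq_AE)
         (use vimage in \<open>auto intro!: sets.Int\<close>)
    also have "{0<..<1} \<inter> quantile L -` A = I -` A \<inter> {0<..<1}"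
      by (auto simp: quantile_def)
    also have "emeasure lborel \<dots> = emeasure (distr (restrict_space lborel {0<..<1}) borel I) A"
      by (subst emeasure_distr) (auto simp: space_restrict_space emeasure_restrict_space
           intro!: measurable_restrict_space1)
    finally show ?thesis .
  qed
  then have "distr (uniform_measure lborel {0..1}) borel (quantile L)
      = distr (restrict_space lborel {0<..<1}) borel I"
    by (intro measure_eqI) auto
  then show ?thesis
    using distr_I_eq_M by simp
qed

lemma quantile_mono:
  assumes "real_distribution L" "real_distribution L'"
    and "\<And>x. cdf L' x \<le> cdf L x"
  shows "quantile L u \<le> quantile L' u"
proof (cases "u \<in> {0<..<1}")
  case True
  interpret L: cdf_distribution L
    using assms by (simp add: cdf_distribution_def)
  interpret L': cdf_distribution L'
    using assms by (simp add: cdf_distribution_def)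
  have "u \<le> cdf L' (L'.I u)"
    using True L'.pseudoinverse[of u "L'.I u"] by simp
  also have "\<dots> \<le> cdf L (L'.I u)"
    by (rule assms)
  finally show ?thesis
    using True L.pseudoinverse[of u "L'.I u"] by (simp add: quantile_def)
qed (auto simp: quantile_def)

lemma Lp_distr_iff:
  assumes "X \<in> borel_measurable Q"
  shows "X \<in> Lp Q q \<longleftrightarrow> integrable (distr Q borel X) (\<lambda>x. \<bar>x\<bar> powr q)"
  using assms by (simp add: Lp_def integrable_distr_eq)

text \<open>A monetary risk measure is monotone for random variables on its own base space. To transport
  this to an arbitrary probability space \<open>Q\<close>, both variables on \<open>Q\<close> are replaced by the
  quantile functions of their laws, applied to one uniform variable on the base space: this
  preserves both laws, and stochastic dominance becomes a pointwise inequality. An almost sure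
  inequality under \<open>Q\<close> suffices, because it already orders the distribution functions.\<close>

lemma risk_at_law_mono:
  assumes "atomless_prob_space M" "monetary M q \<rho>" "law_invariant M q \<rho>"
    and "prob_space Q" "X \<in> Lp Q q" "X' \<in> Lp Q q" "AE y in Q. X y \<le> X' y"
  shows "risk_at_law M q \<rho> (distr Q borel X) \<le> risk_at_law M q \<rho> (distr Q borel X')"
proof -
  interpret Q: prob_space Q by fact
  have [measurable]: "X \<in> borel_measurable Q" "X' \<in> borel_measurable Q"
    using assms(5,6) by (auto simp: Lp_def)
  obtain U where U[measurable]: "U \<in> borel_measurable M"
    and U_law: "distr M borel U = uniform_measure lborel {0..1::real}"
    using assms(1) by (auto simp: atomless_prob_space_def)
  define W where "W Y = (\<lambda>w. quantile (distr Q borel Y) (U w))" for Y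
  have dist: "real_distribution (distr Q borel Y)" if "Y \<in> borel_measurable Q" for Y
    using that by simp
  have W_law: "distr M borel (W Y) = distr Q borel Y" if Y: "Y \<in> borel_measurable Q" for Y
  proof -
    have "distr M borel (W Y) = distr (distr M borel U) borel (quantile (distr Q borel Y))"
      unfolding W_def using measurable_quantile[OF dist[OF Y]]
      by (subst distr_distr) (auto simp: comp_def)
    then show ?thesis
      using U_law distr_quantile_uniform[OF dist[OF Y]] by simp
  qed
  have W_Lp: "W Y \<in> Lp M q" if "Y \<in> Lp Q q" for Y
  proof -
    have Y: "Y \<in> borel_measurable Q"
      using that by (simp add: Lp_def)
    have "W Y \<in> borel_measurable M"
      unfolding W_def using measurable_quantile[OF dist[OF Y]] by measurable
    then show ?thesis
      using that Lp_distr_iff[of "W Y" M q] Lp_distr_iff[OF Y, of q] W_law[OF Y] by simp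
  qed
  have cdf_le: "cdf (distr Q borel X') x \<le> cdf (distr Q borel X) x" for x
    unfolding cdf_def measure_distr[OF \<open>X \<in> borel_measurable Q\<close> atMost_borel]
      measure_distr[OF \<open>X' \<in> borel_measurable Q\<close> atMost_borel]
    by (rule Q.finite_measure_mono_AE) (use assms(7) in auto)
  have "\<rho> (W X) \<le> \<rho> (W X')"
    using assms(2) W_Lp assms(5,6) quantile_mono[OF dist dist cdf_le]
    unfolding monetary_def by (simp add: W_def)
  moreover have "risk_at_law M q \<rho> (distr Q borel Y) = \<rho> (W Y)" if "Y \<in> Lp Q q" for Y
    using risk_at_law_distr[OF assms(3) W_Lp[OF that]] W_law[of Y] that by (simp add: Lp_def)
  ultimately show ?thesis
    using assms(5,6) by simp
qed

text \<open>All representatives of \<open>Z\<close> in \<open>L\<^sup>q\<close> agree almost everywhere and have the same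
  law, so the choice operator in the definition of \<open>risk_under\<close> is harmless.\<close>

lemma risk_under_eq_risk_at_law:
  assumes "X \<in> Lp Q q" "AE y in Q. Z y = ereal (X y)"
  shows "risk_under M q \<rho> Q Z = ereal (risk_at_law M q \<rho> (distr Q borel X))"
proof -
  let ?P = "\<lambda>X. X \<in> Lp Q q \<and> (AE y in Q. Z y = ereal (X y))"
  define Y where "Y = (SOME X. ?P X)"
  have Y: "?P Y"
    unfolding Y_def by (rule someI[of ?P X]) (use assms in simp)
  then have "AE y in Q. Y y = X y"
    using assms(2) by (auto elim: AE_mp)
  then have "distr Q borel Y = distr Q borel X"
    by (intro distr_cong_AE) (use Y assms in \<open>auto simp: Lp_def\<close>)
  then show ?thesis
    using assms unfolding risk_under_def Y_def[symmetric] by auto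
qed

text \<open>Both branches of the definition of \<open>risk_under\<close> are given by the upper extension: when \<open>Z\<close> is
  almost everywhere an \<open>L\<^sup>q\<close> function \<open>X\<close>, the infimum over the dominating functions is
  attained at \<open>X\<close>. For the upper extension, enlarging \<open>Z\<close> only shrinks the set of dominating
  functions.\<close>

lemma risk_under_mono:
  assumes "atomless_prob_space M" "monetary M q \<rho>" "law_invariant M q \<rho>"
    and "prob_space Q" "AE y in Q. Z y \<le> Z' y"
  shows "risk_under M q \<rho> Q Z \<le> risk_under M q \<rho> Q Z'"
proof -
  note mono = risk_at_law_mono[OF assms(1-4)]
  let ?up = "\<lambda>Z. {X \<in> Lp Q q. AE y in Q. Z y \<le> ereal (X y)}"
  let ?law = "\<lambda>X. ereal (risk_at_law M q \<rho> (distr Q borel X))"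
  have as_INF: "risk_under M q \<rho> Q Z = (INF X\<in>?up Z. ?law X)" for Z
  proof (cases "\<exists>X\<in>Lp Q q. AE y in Q. Z y = ereal (X y)")
    case True
    then obtain X where X: "X \<in> Lp Q q" "AE y in Q. Z y = ereal (X y)"
      by blast
    have "X \<in> ?up Z"
      using X by (auto elim: AE_mp)
    moreover have "?law X \<le> ?law Y" if "Y \<in> ?up Z" for Y
    proof -
      have "AE y in Q. X y \<le> Y y"
        using X(2) that by (auto elim: AE_mp)
      then show ?thesis
        using mono X(1) that by simp
    qed
    ultimately have "(INF X\<in>?up Z. ?law X) = ?law X"
      by (intro antisym INF_greatest INF_lower)
    then show ?thesis
      using risk_under_eq_risk_at_law[OF X] by simp
  qed (simp add: risk_under_def)
  have "AE y in Q. Z y \<le> ereal (X y)" if "AE y in Q. Z' y \<le> ereal (X y)" for X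
    using assms(5) that by eventually_elim (rule order_trans)
  then have "?up Z' \<subseteq> ?up Z"
    by blast
  then show ?thesis
    unfolding as_INF by (rule INF_superset_mono) simp
qed

section \<open>Bayes updates stay in the belief space\<close>

text \<open>A Caratheodory function is jointly measurable: it is the limit of the functions obtained by
  moving \<open>\<theta>\<close> to the first point, within distance \<open>1/(n+1)\<close>, of a countable dense subset of \<open>A\<close>,
  and these take countably many parameter values. This makes the likelihood
  jointly measurable, so that the order of integration can be exchanged.\<close>

lemma borel_measurable_continuous_in_parameter:
  fixes f :: "'x \<Rightarrow> 'p::{metric_space, second_countable_topology} \<Rightarrow> 'b::metric_space"
  assumes meas: "\<And>\<theta>. \<theta> \<in> A \<Longrightarrow> (\<lambda>x. f x \<theta>) \<in> borel_measurable M"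
    and cont: "\<And>x. x \<in> space M \<Longrightarrow> continuous_on A (f x)"
  shows "(\<lambda>(x, \<theta>). f x \<theta>) \<in> borel_measurable (M \<Otimes>\<^sub>M restrict_space borel A)"
proof (cases "A = {}")
  case True
  then show ?thesis
    by (intro measurableI) (auto simp: space_pair_measure space_restrict_space)
next
  case False
  obtain T where T: "countable T" "T \<subseteq> A" "A \<subseteq> closure T"
    using separable .
  then have "T \<noteq> {}"
    using False by auto
  define d where "d = from_nat_into T"
  have d_in: "d i \<in> A" for i
    using T(2) from_nat_into[OF \<open>T \<noteq> {}\<close>, of i] by (auto simp: d_def)
  define i where "i n \<theta> = (LEAST k. dist \<theta> (d k) < 1 / real (Suc n))" for n \<theta>
  have close: "dist \<theta> (d (i n \<theta>)) < 1 / real (Suc n)" if \<theta>: "\<theta> \<in> A" for n \<theta>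
  proof -
    have "\<exists>y\<in>T. dist y \<theta> < 1 / real (Suc n)"
      using subsetD[OF T(3) \<theta>] unfolding closure_approachable
      by (metis of_nat_0_less_iff zero_less_Suc zero_less_divide_1_iff)
    then obtain y where y: "y \<in> T" "dist y \<theta> < 1 / real (Suc n)"
      by blast
    then obtain k where "d k = y"
      using from_nat_into_surj[OF T(1)] by (auto simp: d_def)
    then have "dist \<theta> (d k) < 1 / real (Suc n)"
      using y by (simp add: dist_commute)
    then show ?thesis
      unfolding i_def by (rule LeastI)
  qed
  have [measurable]: "i n \<in> measurable borel (count_space UNIV)" for n
    unfolding i_def by measurable
  show ?thesis
  proof (rule borel_measurable_LIMSEQ_metric)
    fix n
    have "(\<lambda>z. f (fst z) (d k)) \<in> borel_measurable (M \<Otimes>\<^sub>M restrict_space borel A)" for k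
      using meas[OF d_in] by measurable
    moreover have "(\<lambda>z. i n (snd z)) \<in> measurable (M \<Otimes>\<^sub>M restrict_space borel A) (count_space UNIV)"
      by (rule measurable_compose[OF measurable_snd]) (rule measurable_restrict_space1, simp)
    ultimately show "(\<lambda>z. f (fst z) (d (i n (snd z)))) \<in> borel_measurable (M \<Otimes>\<^sub>M restrict_space borel A)"
      by (rule measurable_compose_countable)
  next
    fix z assume "z \<in> space (M \<Otimes>\<^sub>M restrict_space borel A)"
    then obtain x \<theta> where z: "z = (x, \<theta>)" "x \<in> space M" "\<theta> \<in> A"
      by (auto simp: space_pair_measure space_restrict_space)
    have "(\<lambda>n. dist (d (i n \<theta>)) \<theta>) \<longlonglongrightarrow> 0"
    proof (rule tendsto_sandwich[where f = "\<lambda>_. 0" and h = "\<lambda>n. 1 / real (Suc n)"])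
      show "\<forall>\<^sub>F n in sequentially. dist (d (i n \<theta>)) \<theta> \<le> 1 / real (Suc n)"
        using close[OF z(3)]
        by (intro always_eventually allI) (subst dist_commute, rule less_imp_le)
      show "(\<lambda>n. 1 / real (Suc n)) \<longlonglongrightarrow> 0"
        by (rule LIMSEQ_Suc[OF lim_1_over_n])
    qed auto
    then have "(\<lambda>n. d (i n \<theta>)) \<longlonglongrightarrow> \<theta>"
      by (subst tendsto_dist_iff)
    then have "(\<lambda>n. f x (d (i n \<theta>))) \<longlonglongrightarrow> f x \<theta>"
      by (rule continuous_on_tendsto_compose[OF cont[OF z(2)] _ z(3)]) (simp add: d_in)
    then show "(\<lambda>n. f (fst z) (d (i n (snd z)))) \<longlonglongrightarrow> (case z of (x, \<theta>) \<Rightarrow> f x \<theta>)"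
      by (simp add: z(1))
  qed
qed

lemma closed_msupport: "closed (msupport Q)"
proof -
  have "- msupport Q = \<Union>{U. open U \<and> emeasure Q U = 0}"
    by (auto simp: msupport_def not_less)
  then show ?thesis
    by (simp add: closed_def open_Union)
qed

lemma belief_lawD:
  assumes "\<mu> \<in> beliefs D"
  shows "\<mu> \<in> borel_measurable borel" "\<And>\<theta>. 0 \<le> \<mu> \<theta>" "\<And>\<theta>. \<theta> \<notin> params D \<Longrightarrow> \<mu> \<theta> = 0"
    and "prob_space (belief_law \<mu>)" "integrable (belief_law \<mu>) (\<lambda>\<theta>. \<bar>\<theta>\<bar> powr outer_exp D)"
  using assms by (auto simp: beliefs_def finite_moment_def)

lemma AE_belief_law:
  assumes "\<mu> \<in> beliefs D"
  shows "(AE \<theta> in belief_law \<mu>. P \<theta>) \<longleftrightarrow> (AE \<theta> in lborel. \<mu> \<theta> \<noteq> 0 \<longrightarrow> P \<theta>)"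
proof -
  have "ennreal (\<mu> \<theta>) > 0 \<longleftrightarrow> \<mu> \<theta> \<noteq> 0" for \<theta>
    using belief_lawD(2)[OF assms, of \<theta>] by auto
  then show ?thesis
    using belief_lawD(1)[OF assms] unfolding belief_law_def by (subst AE_density) auto
qed

text \<open>Write \<open>m(x)\<close> for the evidence \<open>\<integral> p(x|\<theta>) \<mu>(\<theta>) d\<theta>\<close>. By Fubini, averaging the unnormalized
  posteriors over all observations gives back the prior, so \<open>m\<close> and the unnormalized posterior
  moment \<open>\<integral> |\<theta>|\<^sup>p p(x|\<theta>) \<mu>(\<theta>) d\<theta>\<close> have finite integrals over \<open>x\<close> and are finite almost
  everywhere. Where \<open>m(x) = 0\<close>, the product \<open>p(x|\<theta>) \<mu>(\<theta>)\<close> vanishes for almost every \<open>\<theta>\<close>;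
  exchanging the two quantifiers, for almost every \<open>\<theta>\<close> with \<open>\<mu>(\<theta>) > 0\<close> the observations with
  \<open>m(x) = 0\<close> are negligible under \<open>P\<^sub>\<theta>\<close>. Outside these exceptional observations, dividing by
  \<open>m(x)\<close> gives a probability density with a finite moment.\<close>

lemma AE_bayes_update_beliefs:
  fixes D :: "('s::topological_space, 'a::real_normed_vector, 'x::euclidean_space, 'w) bcr"
  assumes D: "bcr_problem D" and cont: "assumption_d D" and \<mu>: "\<mu> \<in> beliefs D"
  shows "AE \<theta> in belief_law \<mu>. AE x in family D \<theta>. x \<in> outcomes D \<and> bayes_update D \<mu> x \<in> beliefs D"
proof -
  let ?p = "outer_exp D"
  note [measurable] = belief_lawD(1)[OF \<mu>]
  have sets_dom[measurable_cong]: "sets (dom D) = sets borel"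
    using D by (simp add: bcr_problem_def)
  have [measurable]: "params D \<in> sets borel"
    using D by (simp add: bcr_problem_def)
  have [measurable]: "outcomes D \<in> sets borel"
    using D closed_msupport[of "family D (true_param D)"] by (simp add: bcr_problem_def)
  have lik_meas: "(\<lambda>x. lik D x \<theta>) \<in> borel_measurable borel"
    and lik_nonneg: "0 \<le> lik D x \<theta>"
    and family: "family D \<theta> = density (dom D) (\<lambda>x. ennreal (lik D x \<theta>))"
    and prob: "prob_space (family D \<theta>)"
    and in_outcomes: "AE x in family D \<theta>. x \<in> outcomes D" if "\<theta> \<in> params D" for x \<theta>
    using D that unfolding bcr_problem_def by blast+
  interpret dom: sigma_finite_measure "dom D"
    using D by (simp add: bcr_problem_def)
  interpret pair_sigma_finite "dom D" lborel ..

  \<comment> \<open>Continuity in the parameter is known only for observations in the support,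
    so the likelihood is set to zero elsewhere.\<close>
  define L where "L x \<theta> = (if x \<in> outcomes D \<and> \<theta> \<in> params D then lik D x \<theta> else 0)" for x \<theta>
  have L_nonneg: "0 \<le> L x \<theta>" for x \<theta>
    using lik_nonneg by (simp add: L_def)
  have "(\<lambda>(x, \<theta>). lik D x \<theta>) \<in> borel_measurable
      (restrict_space borel (outcomes D) \<Otimes>\<^sub>M restrict_space borel (params D))"
    using cont lik_meas
    by (intro borel_measurable_continuous_in_parameter measurable_restrict_space1)
       (auto simp: assumption_d_def space_restrict_space)
  moreover have "(\<lambda>z. (fst z, snd z)) \<in> restrict_space (borel \<Otimes>\<^sub>M borel) (outcomes D \<times> params D)
      \<rightarrow>\<^sub>M restrict_space borel (outcomes D) \<Otimes>\<^sub>M restrict_space borel (params D)"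
    by (intro measurable_Pair measurable_restrict_space2 measurable_restrict_space1)
       (auto simp: space_restrict_space)
  ultimately have "(\<lambda>(x, \<theta>). lik D x \<theta>)
      \<in> borel_measurable (restrict_space (borel \<Otimes>\<^sub>M borel) (outcomes D \<times> params D))"
    using measurable_compose by fastforce
  then have "(\<lambda>z. if z \<in> outcomes D \<times> params D then (\<lambda>(x, \<theta>). lik D x \<theta>) z else 0)
      \<in> borel_measurable (borel \<Otimes>\<^sub>M borel)"
    by (subst (asm) measurable_restrict_space_iff) (auto simp: space_pair_measure)
  then have [measurable]: "(\<lambda>(x, \<theta>). L x \<theta>) \<in> borel_measurable (borel \<Otimes>\<^sub>M borel)"
    by (rule measurable_cong[THEN iffD1, rotated]) (auto simp: L_def split: if_splits)

  define evidence where "evidence x = (\<integral>\<^sup>+\<theta>. ennreal (L x \<theta> * \<mu> \<theta>) \<partial>lborel)" for x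
  define moment where "moment x = (\<integral>\<^sup>+\<theta>. ennreal (L x \<theta> * \<mu> \<theta>) * ennreal (\<bar>\<theta>\<bar> powr ?p) \<partial>lborel)" for x
  have [measurable]: "evidence \<in> borel_measurable borel" "moment \<in> borel_measurable borel"
    unfolding evidence_def[abs_def] moment_def[abs_def] by measurable
  note mu_nonneg = belief_lawD(2)[OF \<mu>]

  have L_eq_lik: "AE x in dom D. L x \<theta> = lik D x \<theta>" if \<theta>: "\<theta> \<in> params D" for \<theta>
  proof -
    have "AE x in dom D. 0 < ennreal (lik D x \<theta>) \<longrightarrow> x \<in> outcomes D"
      using in_outcomes[OF \<theta>] lik_meas[OF \<theta>] unfolding family[OF \<theta>] by (subst (asm) AE_density) auto
    then show ?thesis
      by eventually_elim (use \<theta> lik_nonneg[OF \<theta>] in \<open>auto simp: L_def less_le\<close>)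
  qed
  have AE_family: "(AE x in family D \<theta>. P x) \<longleftrightarrow> (AE x in dom D. L x \<theta> \<noteq> 0 \<longrightarrow> P x)"
    if \<theta>: "\<theta> \<in> params D" for P \<theta>
  proof -
    have "(AE x in family D \<theta>. P x) \<longleftrightarrow> (AE x in dom D. 0 < ennreal (lik D x \<theta>) \<longrightarrow> P x)"
      using lik_meas[OF \<theta>] unfolding family[OF \<theta>] by (subst AE_density) auto
    also have "\<dots> \<longleftrightarrow> (AE x in dom D. L x \<theta> \<noteq> 0 \<longrightarrow> P x)"
      by (rule eventually_subst)
         (use L_eq_lik[OF \<theta>] in eventually_elim, use lik_nonneg[OF \<theta>] in \<open>auto simp: less_le\<close>)
    finally show ?thesis .
  qed
  have L_total: "(\<integral>\<^sup>+x. ennreal (L x \<theta>) \<partial>dom D) = 1" if \<theta>: "\<theta> \<in> params D" for \<theta>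
  proof -
    have "(\<integral>\<^sup>+x. ennreal (L x \<theta>) \<partial>dom D) = (\<integral>\<^sup>+x. ennreal (lik D x \<theta>) * indicator UNIV x \<partial>dom D)"
      by (rule nn_integral_cong_AE) (use L_eq_lik[OF \<theta>] in eventually_elim, simp)
    also have "\<dots> = emeasure (family D \<theta>) UNIV"
      using lik_meas[OF \<theta>] unfolding family[OF \<theta>] by (subst emeasure_density) auto
    also have "\<dots> = 1"
      using prob_space.emeasure_space_1[OF prob[OF \<theta>]] family[OF \<theta>] sets_eq_imp_space_eq[OF sets_dom]
      by simp
    finally show ?thesis .
  qed

  \<comment> \<open>Each \<open>P\<^sub>\<theta>\<close> has total mass one, so the unnormalized posteriors mix back to the prior.\<close>
  have mixture: "(\<integral>\<^sup>+x. (\<integral>\<^sup>+\<theta>. ennreal (L x \<theta> * \<mu> \<theta>) * h \<theta> \<partial>lborel) \<partial>dom D) = (\<integral>\<^sup>+\<theta>. h \<theta> \<partial>belief_law \<mu>)"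
    if [measurable]: "h \<in> borel_measurable borel" for h
  proof -
    have "(\<integral>\<^sup>+x. (\<integral>\<^sup>+\<theta>. ennreal (L x \<theta> * \<mu> \<theta>) * h \<theta> \<partial>lborel) \<partial>dom D)
        = (\<integral>\<^sup>+\<theta>. (\<integral>\<^sup>+x. ennreal (L x \<theta> * \<mu> \<theta>) * h \<theta> \<partial>dom D) \<partial>lborel)"
      by (rule Fubini'[symmetric]) measurable
    also have "\<dots> = (\<integral>\<^sup>+\<theta>. ennreal (\<mu> \<theta>) * h \<theta> \<partial>lborel)"
    proof (rule nn_integral_cong)
      fix \<theta>
      have "(\<integral>\<^sup>+x. ennreal (L x \<theta> * \<mu> \<theta>) * h \<theta> \<partial>dom D)
          = (\<integral>\<^sup>+x. ennreal (L x \<theta>) * (ennreal (\<mu> \<theta>) * h \<theta>) \<partial>dom D)"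
        using L_nonneg mu_nonneg by (simp add: ennreal_mult mult.assoc)
      also have "\<dots> = (\<integral>\<^sup>+x. ennreal (L x \<theta>) \<partial>dom D) * (ennreal (\<mu> \<theta>) * h \<theta>)"
        by (rule nn_integral_multc) measurable
      also have "\<dots> = ennreal (\<mu> \<theta>) * h \<theta>"
        using L_total[of \<theta>] belief_lawD(3)[OF \<mu>, of \<theta>] by (cases "\<theta> \<in> params D") auto
      finally show "(\<integral>\<^sup>+x. ennreal (L x \<theta> * \<mu> \<theta>) * h \<theta> \<partial>dom D) = ennreal (\<mu> \<theta>) * h \<theta>" .
    qed
    also have "\<dots> = (\<integral>\<^sup>+\<theta>. h \<theta> \<partial>belief_law \<mu>)"
      unfolding belief_law_def by (subst nn_integral_density) auto
    finally show ?thesis .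
  qed
  have evidence_finite: "AE x in dom D. evidence x \<noteq> \<infinity>"
  proof (rule nn_integral_noteq_infinite)
    have "(\<integral>\<^sup>+x. evidence x \<partial>dom D) = emeasure (belief_law \<mu>) (space (belief_law \<mu>))"
      using mixture[of "\<lambda>_. 1"] by (simp add: evidence_def)
    then show "(\<integral>\<^sup>+x. evidence x \<partial>dom D) \<noteq> \<infinity>"
      using prob_space.emeasure_space_1[OF belief_lawD(4)[OF \<mu>]] by simp
  qed measurable
  have moment_finite: "AE x in dom D. moment x \<noteq> \<infinity>"
  proof (rule nn_integral_noteq_infinite)
    have "(\<integral>\<^sup>+x. moment x \<partial>dom D) = (\<integral>\<^sup>+\<theta>. ennreal (\<bar>\<theta>\<bar> powr ?p) \<partial>belief_law \<mu>)"
      using mixture[of "\<lambda>\<theta>. ennreal (\<bar>\<theta>\<bar> powr ?p)"] by (simp add: moment_def)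
    then show "(\<integral>\<^sup>+x. moment x \<partial>dom D) \<noteq> \<infinity>"
      using belief_lawD(5)[OF \<mu>] unfolding integrable_iff_bounded by (auto simp del: infinity_ennreal_def)
  qed measurable

  have "AE x in dom D. AE \<theta> in lborel. evidence x = 0 \<longrightarrow> L x \<theta> * \<mu> \<theta> = 0"
  proof (rule AE_I2)
    fix x
    show "AE \<theta> in lborel. evidence x = 0 \<longrightarrow> L x \<theta> * \<mu> \<theta> = 0"
    proof (cases "evidence x = 0")
      case True
      then have "AE \<theta> in lborel. ennreal (L x \<theta> * \<mu> \<theta>) = 0"
        unfolding evidence_def by (subst (asm) nn_integral_0_iff_AE) measurable
      then show ?thesis
      proof eventually_elim
        case (elim \<theta>)
        moreover have "0 \<le> L x \<theta> * \<mu> \<theta>"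
          using L_nonneg mu_nonneg by (rule mult_nonneg_nonneg)
        ultimately have "L x \<theta> * \<mu> \<theta> = 0"
          by (simp only: ennreal_eq_0_iff order.antisym)
        then show ?case ..
      qed
    qed simp
  qed
  then have evidence_pos:
    "AE \<theta> in lborel. AE x in dom D. evidence x = 0 \<longrightarrow> L x \<theta> * \<mu> \<theta> = 0"
    by (subst (asm) AE_commute) measurable

  have update: "bayes_update D \<mu> x \<in> beliefs D"
    if x: "x \<in> outcomes D" and e0: "evidence x \<noteq> 0" and e1: "evidence x \<noteq> \<infinity>"
      and m: "moment x \<noteq> \<infinity>" for x
  proof -
    define c where "c = enn2real (evidence x)"
    have c: "0 < c" "evidence x = ennreal c"
      using e0 e1 by (auto simp: c_def enn2real_positive_iff less_top zero_less_iff_neq_zero)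
    have "(LINT \<theta>:params D|lborel. lik D x \<theta> * \<mu> \<theta>) = (LINT \<theta>|lborel. L x \<theta> * \<mu> \<theta>)"
      unfolding set_lebesgue_integral_def
      by (rule Bochner_Integration.integral_cong) (auto simp: L_def x indicator_def)
    also have "\<dots> = c"
      unfolding c_def evidence_def using L_nonneg mu_nonneg
      by (intro integral_eq_nn_integral) auto
    finally have upd: "bayes_update D \<mu> x = (\<lambda>\<theta>. L x \<theta> * \<mu> \<theta> / c)"
      using x belief_lawD(3)[OF \<mu>] by (auto simp: bayes_update_def L_def fun_eq_iff)
    have law: "(\<integral>\<^sup>+\<theta>. h \<theta> \<partial>belief_law (\<lambda>\<theta>. L x \<theta> * \<mu> \<theta> / c))
        = (\<integral>\<^sup>+\<theta>. ennreal (L x \<theta> * \<mu> \<theta>) * h \<theta> \<partial>lborel) / ennreal c"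
      if [measurable]: "h \<in> borel_measurable borel" for h
    proof -
      have "(\<integral>\<^sup>+\<theta>. h \<theta> \<partial>belief_law (\<lambda>\<theta>. L x \<theta> * \<mu> \<theta> / c))
          = (\<integral>\<^sup>+\<theta>. ennreal (L x \<theta> * \<mu> \<theta> / c) * h \<theta> \<partial>lborel)"
        unfolding belief_law_def by (subst nn_integral_density) auto
      also have "\<dots> = (\<integral>\<^sup>+\<theta>. (ennreal (L x \<theta> * \<mu> \<theta>) * h \<theta>) / ennreal c \<partial>lborel)"
        using L_nonneg mu_nonneg c(1)
        by (simp add: divide_ennreal[symmetric] divide_ennreal_def mult_ac)
      also have "\<dots> = (\<integral>\<^sup>+\<theta>. ennreal (L x \<theta> * \<mu> \<theta>) * h \<theta> \<partial>lborel) / ennreal c"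
        by (rule nn_integral_divide) measurable
      finally show ?thesis .
    qed
    have "emeasure (belief_law (\<lambda>\<theta>. L x \<theta> * \<mu> \<theta> / c)) (space (belief_law (\<lambda>\<theta>. L x \<theta> * \<mu> \<theta> / c))) = 1"
      using law[of "\<lambda>_. 1"] c ennreal_divide_self[of "ennreal c"] by (simp add: evidence_def)
    then have "prob_space (belief_law (\<lambda>\<theta>. L x \<theta> * \<mu> \<theta> / c))"
      by (rule prob_spaceI)
    moreover have "integrable (belief_law (\<lambda>\<theta>. L x \<theta> * \<mu> \<theta> / c)) (\<lambda>\<theta>. norm \<theta> powr ?p)"
    proof -
      have "moment x / ennreal c < \<infinity>"
        using m c(1) by (auto simp: ennreal_divide_eq_top_iff less_top[symmetric])
      then have "(\<integral>\<^sup>+\<theta>. ennreal (\<bar>\<theta>\<bar> powr ?p) \<partial>belief_law (\<lambda>\<theta>. L x \<theta> * \<mu> \<theta> / c)) < \<infinity>"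
        using law[of "\<lambda>\<theta>. ennreal (\<bar>\<theta>\<bar> powr ?p)"] by (simp add: moment_def)
      moreover have "(\<lambda>\<theta>. \<bar>\<theta>\<bar> powr ?p) \<in> borel_measurable (belief_law (\<lambda>\<theta>. L x \<theta> * \<mu> \<theta> / c))"
        unfolding belief_law_def by simp
      ultimately show ?thesis
        by (simp add: integrable_iff_bounded)
    qed
    moreover have "sets (belief_law (\<lambda>\<theta>. L x \<theta> * \<mu> \<theta> / c)) = sets borel"
      by (simp add: belief_law_def)
    moreover have "(\<lambda>\<theta>. L x \<theta> * \<mu> \<theta> / c) \<in> borel_measurable borel"
      by measurable
    moreover have "0 \<le> L x \<theta> * \<mu> \<theta> / c" for \<theta>
      using L_nonneg mu_nonneg c(1) by (intro divide_nonneg_pos mult_nonneg_nonneg)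
    moreover have "L x \<theta> * \<mu> \<theta> / c = 0" if "\<theta> \<notin> params D" for \<theta>
      using belief_lawD(3)[OF \<mu> that] by simp
    ultimately show ?thesis
      unfolding upd beliefs_def finite_moment_def by blast
  qed

  have "AE \<theta> in lborel. \<mu> \<theta> \<noteq> 0 \<longrightarrow>
      (AE x in family D \<theta>. x \<in> outcomes D \<and> bayes_update D \<mu> x \<in> beliefs D)"
    using evidence_pos
  proof eventually_elim
    case (elim \<theta>)
    show ?case
    proof
      assume "\<mu> \<theta> \<noteq> 0"
      then have \<theta>: "\<theta> \<in> params D"
        using belief_lawD(3)[OF \<mu>] by blast
      have "AE x in dom D. L x \<theta> \<noteq> 0 \<longrightarrow> x \<in> outcomes D \<and> bayes_update D \<mu> x \<in> beliefs D"
        using elim evidence_finite moment_finite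
      proof eventually_elim
        case (elim x)
        show ?case
        proof
          assume "L x \<theta> \<noteq> 0"
          then have "x \<in> outcomes D" "evidence x \<noteq> 0"
            using elim(1) \<open>\<mu> \<theta> \<noteq> 0\<close> by (auto simp: L_def split: if_splits)
          then show "x \<in> outcomes D \<and> bayes_update D \<mu> x \<in> beliefs D"
            using update elim(2,3) by blast
        qed
      qed
      then show "AE x in family D \<theta>. x \<in> outcomes D \<and> bayes_update D \<mu> x \<in> beliefs D"
        by (subst AE_family[OF \<theta>])
    qed
  qed
  then show ?thesis
    by (subst AE_belief_law[OF \<mu>])
qed

section \<open>Dynamic programming\<close>

text \<open>It suffices to compare continuation values on the state space and the belief space: for almost
  every parameter, almost every observation leads to a next state and a posterior there, and both
  layers of the composite risk ignore null sets.\<close>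

lemma stage_risk_mono:
  fixes D :: "('s::topological_space, 'a::real_normed_vector, 'x::euclidean_space, 'w) bcr"
  assumes D: "bcr_problem D" and b: "assumption_b D \<mu>1" and d: "assumption_d D"
    and t: "t \<in> {1..<horizon D}" and s: "s \<in> states D" and \<mu>: "\<mu> \<in> beliefs D"
    and a: "a \<in> actions D"
    and le: "\<And>s' \<mu>'. s' \<in> states D \<Longrightarrow> \<mu>' \<in> beliefs D \<Longrightarrow> V s' \<mu>' \<le> W s' \<mu>'"
  shows "stage_risk D t V s \<mu> a \<le> stage_risk D t W s \<mu> a"
proof -
  have base: "atomless_prob_space (base D)"
    and outer: "monetary (base D) (outer_exp D) (outer D)"
      "law_invariant (base D) (outer_exp D) (outer D)"
    and prob: "\<And>\<theta>. \<theta> \<in> params D \<Longrightarrow> prob_space (family D \<theta>)"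
    and trans: "\<And>x. x \<in> outcomes D \<Longrightarrow> trans_map D t s a x \<in> states D"
    and discount: "0 < discount D"
    using D t s a by (auto simp: bcr_problem_def)
  have inner: "monetary (base D) (inner_exp D) (inner D)"
      "law_invariant (base D) (inner_exp D) (inner D)"
    using b by (auto simp: assumption_b_def)
  let ?Z = "\<lambda>V x. ereal (stage_cost D t s a x)
      + ereal (discount D) * V (trans_map D t s a x) (bayes_update D \<mu> x)"
  let ?inner = "\<lambda>\<theta>. risk_under (base D) (inner_exp D) (inner D) (family D \<theta>)"
  have in_params: "AE \<theta> in belief_law \<mu>. \<theta> \<in> params D"
    using belief_lawD(3)[OF \<mu>] by (auto simp: AE_belief_law[OF \<mu>])
  have "AE \<theta> in belief_law \<mu>. ?inner \<theta> (?Z V) \<le> ?inner \<theta> (?Z W)"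
    using in_params AE_bayes_update_beliefs[OF D d \<mu>]
  proof eventually_elim
    case (elim \<theta>)
    from elim(2) have "AE x in family D \<theta>. ?Z V x \<le> ?Z W x"
    proof eventually_elim
      case (elim x)
      then show ?case
        using le[OF trans] discount by (intro add_left_mono ereal_mult_left_mono) auto
    qed
    then show ?case
      by (rule risk_under_mono[OF base inner prob[OF elim(1)]])
  qed
  then show ?thesis
    unfolding stage_risk_def composite_risk_def
    by (rule risk_under_mono[OF base outer belief_lawD(4)[OF \<mu>]])
qed

text \<open>Backward induction. By monotonicity, replacing the continuation cost of \<open>\<pi>\<close> by the smaller
  optimal value lowers the stage risk, and the action of \<open>\<pi>\<close> competes in the infimum.\<close>

lemma opt_value_le_policy_cost:
  fixes D :: "('s::topological_space, 'a::real_normed_vector, 'x::euclidean_space, 'w) bcr"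
  assumes D: "bcr_problem D" and b: "assumption_b D \<mu>1" and d: "assumption_d D"
    and \<pi>: "\<pi> \<in> policies D"
  shows "1 \<le> t \<Longrightarrow> s \<in> states D \<Longrightarrow> \<mu> \<in> beliefs D \<Longrightarrow> opt_value D t s \<mu> \<le> policy_cost D \<pi> t s \<mu>"
proof (induction "horizon D - t" arbitrary: t s \<mu>)
  case 0
  then show ?case
    by (simp add: opt_value.simps[of D t] policy_cost.simps[of D \<pi> t])
next
  case (Suc n)
  then have t: "t \<in> {1..<horizon D}"
    by auto
  then have act: "\<pi> t s \<mu> \<in> actions D"
    using \<pi> Suc.prems by (auto simp: policies_def)
  have "opt_value D t s \<mu> \<le> stage_risk D t (opt_value D (Suc t)) s \<mu> (\<pi> t s \<mu>)"
    using t act by (subst opt_value.simps) (auto intro: INF_lower)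
  also have "\<dots> \<le> stage_risk D t (policy_cost D \<pi> (Suc t)) s \<mu> (\<pi> t s \<mu>)"
    using Suc by (intro stage_risk_mono[OF D b d t _ _ act]) auto
  also have "\<dots> = policy_cost D \<pi> t s \<mu>"
    using t by (simp add: policy_cost.simps[of D \<pi> t])
  finally show ?case .
qed

lemma minimizing_action_iff:
  assumes "t < horizon D"
  shows "minimizing_action D t s \<mu> a \<longleftrightarrow>
    a \<in> actions D \<and> stage_risk D t (opt_value D (Suc t)) s \<mu> a = opt_value D t s \<mu>"
proof -
  let ?f = "stage_risk D t (opt_value D (Suc t)) s \<mu>"
  have opt: "opt_value D t s \<mu> = (INF a\<in>actions D. ?f a)"
    using assms by (subst opt_value.simps) simp
  have "(\<forall>b\<in>actions D. ?f a \<le> ?f b) \<longleftrightarrow> ?f a = opt_value D t s \<mu>" if a: "a \<in> actions D"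
  proof
    assume "\<forall>b\<in>actions D. ?f a \<le> ?f b"
    then show "?f a = opt_value D t s \<mu>"
      unfolding opt by (intro antisym INF_greatest INF_lower a) blast
  next
    assume eq: "?f a = opt_value D t s \<mu>"
    show "\<forall>b\<in>actions D. ?f a \<le> ?f b"
      unfolding eq opt by (intro ballI INF_lower)
  qed
  then show ?thesis
    unfolding minimizing_action_def is_arg_min_def not_ex de_Morgan_conj not_less by blast
qed

lemma recursive_policy_in_policies: "recursive_policy D \<pi> \<Longrightarrow> \<pi> \<in> policies D"
  unfolding recursive_policy_def policies_def minimizing_action_def is_arg_min_def by blast

text \<open>The induction hypothesis gives equality of the continuation values only on the state
  space and the belief space, so equality of the stage risks comes from
  monotonicity in both directions.\<close>

lemma policy_cost_recursive:
  fixes D :: "('s::topological_space, 'a::real_normed_vector, 'x::euclidean_space, 'w) bcr"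
  assumes D: "bcr_problem D" and b: "assumption_b D \<mu>1" and d: "assumption_d D"
    and \<pi>: "recursive_policy D \<pi>"
  shows "1 \<le> t \<Longrightarrow> s \<in> states D \<Longrightarrow> \<mu> \<in> beliefs D \<Longrightarrow> policy_cost D \<pi> t s \<mu> = opt_value D t s \<mu>"
proof (induction "horizon D - t" arbitrary: t s \<mu>)
  case 0
  then show ?case
    by (simp add: opt_value.simps[of D t] policy_cost.simps[of D \<pi> t])
next
  case (Suc n)
  then have t: "t \<in> {1..<horizon D}"
    by auto
  then have act: "\<pi> t s \<mu> \<in> actions D"
    and min: "stage_risk D t (opt_value D (Suc t)) s \<mu> (\<pi> t s \<mu>) = opt_value D t s \<mu>"
    using \<pi> Suc.prems by (auto simp: recursive_policy_def minimizing_action_iff)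
  have "policy_cost D \<pi> t s \<mu> = stage_risk D t (policy_cost D \<pi> (Suc t)) s \<mu> (\<pi> t s \<mu>)"
    using t by (simp add: policy_cost.simps[of D \<pi> t])
  also have "\<dots> = stage_risk D t (opt_value D (Suc t)) s \<mu> (\<pi> t s \<mu>)"
    using Suc by (intro antisym stage_risk_mono[OF D b d t _ _ act]) auto
  finally show ?case
    using min by simp
qed

lemma recursive_policy_exists:
  assumes "\<forall>t\<in>{1..<horizon D}. \<forall>s\<in>states D. \<forall>\<mu>\<in>beliefs D.
      \<exists>a\<in>actions D. stage_risk D t (opt_value D (Suc t)) s \<mu> a = opt_value D t s \<mu>"
  obtains \<pi> where "recursive_policy D \<pi>"
proof
  show "recursive_policy D (\<lambda>t s \<mu>. SOME a. minimizing_action D t s \<mu> a)"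
    unfolding recursive_policy_def
  proof (intro ballI)
    fix t s \<mu> assume "t \<in> {1..<horizon D}" "s \<in> states D" "\<mu> \<in> beliefs D"
    then have "\<exists>a. minimizing_action D t s \<mu> a"
      using assms minimizing_action_iff[of t D s \<mu>] by (metis atLeastLessThan_iff)
    then show "minimizing_action D t s \<mu> (SOME a. minimizing_action D t s \<mu> a)"
      by (rule someI_ex)
  qed
qed

theorem proposition3:
  fixes D :: "('s::topological_space, 'a::real_normed_vector, 'x::euclidean_space, 'w) bcr"
    and s1 :: 's and \<mu>1 :: "real \<Rightarrow> real"
  assumes "bcr_problem D"
    and "assumption_A D \<mu>1"
    and "s1 \<in> states D" and "\<mu>1 \<in> beliefs D"
    and attained: "\<forall>t\<in>{1..<horizon D}. \<forall>s\<in>states D. \<forall>\<mu>\<in>beliefs D.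
      \<exists>a\<in>actions D. stage_risk D t (opt_value D (Suc t)) s \<mu> a = opt_value D t s \<mu>"
  shows "problem_value D s1 \<mu>1 = opt_value D 1 s1 \<mu>1
    \<and> (\<exists>\<pi>. optimal_policy D s1 \<mu>1 \<pi> \<and> recursive_policy D \<pi>)
    \<and> (\<forall>\<pi>. recursive_policy D \<pi> \<longrightarrow> optimal_policy D s1 \<mu>1 \<pi>)"
proof -
  have bd: "assumption_b D \<mu>1" "assumption_d D"
    using assms(2) by (auto simp: assumption_A_def)
  have lower: "opt_value D 1 s1 \<mu>1 \<le> problem_value D s1 \<mu>1"
    unfolding problem_value_def
    using opt_value_le_policy_cost[OF assms(1) bd] assms(3,4) by (intro INF_greatest) auto
  have cost: "policy_cost D \<pi> 1 s1 \<mu>1 = opt_value D 1 s1 \<mu>1" if "recursive_policy D \<pi>" for \<pi>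
    using policy_cost_recursive[OF assms(1) bd that] assms(3,4) by simp
  obtain \<pi>0 where \<pi>0: "recursive_policy D \<pi>0"
    using recursive_policy_exists[OF attained] .
  have "problem_value D s1 \<mu>1 \<le> policy_cost D \<pi>0 1 s1 \<mu>1"
    unfolding problem_value_def by (rule INF_lower) (rule recursive_policy_in_policies[OF \<pi>0])
  then have eq: "problem_value D s1 \<mu>1 = opt_value D 1 s1 \<mu>1"
    using lower cost[OF \<pi>0] by simp
  then have "optimal_policy D s1 \<mu>1 \<pi>" if "recursive_policy D \<pi>" for \<pi>
    using cost[OF that] recursive_policy_in_policies[OF that] by (simp add: optimal_policy_def)
  then show ?thesis
    using eq \<pi>0 by blast
qed

end
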